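(* Let $\mathbb{I}=[0,1]$ and let $d>1$ be an integer. Suppose $f\colon \mathbb{I}^{d-1}\times\mathbb{I}\to[0,\infty)$ is continuous. Then for every $\epsilon>0$ there exist a number of knots $K$ and an un-normalized SPICE model $\hat f\colon \mathbb{I}^{d-1}\times\mathbb{I}\to[0,\infty)$ (i.e. a SPICE model in which the final division by the integral is omitted), whose encoder is a single-hidden-layer feed-forward neural network, such that $$\sup_{(x,y)\in\mathbb{I}^d}\,|f(x,y)-\hat f(x,y)|<\epsilon .$$
   Context: A SPICE model of degree $n\ge 1$ with $K$ knots is defined as follows. A neural network (encoder followed by output layers) maps an input $x\in\mathbb{I}^{d-1}$ to spline parameters: sorted knot positions $0=t_1\le t_2\le\dots\le t_K=1$ and heights. On each interval $[t_i,t_{i+1}]$ one takes the $n+1$ evenly spaced points $\tau_i^j=t_i+(j-1)\frac{t_{i+1}-t_i}{n}$, $j=1,\dots,n+1$, and heights $h_i^1,\dots,h_i^{n+1}$, where consecutive pieces share endpoint heights ($h_i^{n+1}=h_{i+1}^1$), endpoint heights $h_i^1,h_i^{n+1}$ are constrained to be positive, and intermediate heights may be any real numbers (so there are $n(K-1)+1$ heights in total). Let $p_i$ be the unique polynomial of degree at most $n$ interpolating $\{(\tau_i^j,h_i^j)\}_{j=1}^{n+1}$, and let $\bar p_i(y)=\max(p_i(y),0)$. The un-normalized SPICE model is $\hat f(x,y)=\bar p_\ell(y)$ where $\ell$ is chosen so that $t_\ell\le y<t_{\ell+1}$ (with the last piece used at $y=1$), the knot positions and heights being the network's outputs at $x$.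 The (normalized) SPICE conditional density is $\hat f_\theta(y\mid x)=\bar p_\ell(y)\big/\sum_{i=1}^{K-1}\int_{t_i}^{t_{i+1}}\bar p_i(y')\,dy'$. The knot positions may be produced, e.g., by applying a softmax to network outputs to obtain positive widths summing to one and taking cumulative sums; heights at knots are made positive by a softplus. *)

theory Defs
  imports "HOL-Analysis.Analysis" "HOL-Computational_Algebra.Polynomial"
begin

text \<open>The unit cube I^(d-1), with d - 1 = CARD('n) >= 1.\<close>
definition unit_cube :: "(real^'n) set" where
  "unit_cube = {x. \<forall>i. 0 \<le> x $ i \<and> x $ i \<le> 1}"

definition softplus :: "real \<Rightarrow> real" where
  "softplus u = ln (1 + exp u)"

definition encoder :: "(real \<Rightarrow> real) \<Rightarrow> (nat \<Rightarrow> real^'n::finite) \<Rightarrow> (nat \<Rightarrow> real)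
    \<Rightarrow> real^'n \<Rightarrow> nat \<Rightarrow> real" where
  "encoder \<sigma> W b x j = \<sigma> (W j \<bullet> x + b j)"

definition out_layer :: "nat \<Rightarrow> (nat \<Rightarrow> nat \<Rightarrow> real) \<Rightarrow> (nat \<Rightarrow> real)
    \<Rightarrow> (nat \<Rightarrow> real) \<Rightarrow> nat \<Rightarrow> real" where
  "out_layer m A c h i = (\<Sum>j<m. A i j * h j) + c i"

definition knot_width :: "nat \<Rightarrow> (nat \<Rightarrow> real) \<Rightarrow> nat \<Rightarrow> real" where
  "knot_width K z i = exp (z i) / (\<Sum>k<K-1. exp (z k))"

text \<open>Knots t 0 = 0 <= t 1 <= ... <= t (K-1) = 1 (0-based), as cumulative sums.\<close>
definition knots :: "nat \<Rightarrow> (nat \<Rightarrow> real) \<Rightarrow> nat \<Rightarrow> real" where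
  "knots K z i = (\<Sum>k<i. knot_width K z k)"

text \<open>Heights h 0 .. h (n(K-1)); piece i uses h (i*n) .. h (i*n+n); endpoint heights
  (indices divisible by n) are made positive via softplus, the others are raw.\<close>
definition heights :: "nat \<Rightarrow> (nat \<Rightarrow> real) \<Rightarrow> nat \<Rightarrow> real" where
  "heights n r g = (if n dvd g then softplus (r g) else r g)"

definition tau :: "(nat \<Rightarrow> real) \<Rightarrow> nat \<Rightarrow> nat \<Rightarrow> nat \<Rightarrow> real" where
  "tau t n i j = t i + real j * (t (Suc i) - t i) / real n"

definition piece_poly :: "nat \<Rightarrow> (nat \<Rightarrow> real) \<Rightarrow> (nat \<Rightarrow> real) \<Rightarrow> nat \<Rightarrow> real poly" where
  "piece_poly n t h i =
     (THE p. degree p \<le> n \<and> (\<forall>j\<le>n. poly p (tau t n i j) = h (i * n + j)))"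

text \<open>Piece index: the l with t l <= y < t (l+1), last piece used at y = 1.\<close>
definition piece_index :: "nat \<Rightarrow> (nat \<Rightarrow> real) \<Rightarrow> real \<Rightarrow> nat" where
  "piece_index K t y = Max {i. i < K - 1 \<and> t i \<le> y}"

definition spline_val :: "nat \<Rightarrow> nat \<Rightarrow> (nat \<Rightarrow> real) \<Rightarrow> (nat \<Rightarrow> real) \<Rightarrow> real \<Rightarrow> real" where
  "spline_val n K t h y = max (poly (piece_poly n t h (piece_index K t y)) y) 0"

definition spice_unnorm ::
  "(real \<Rightarrow> real) \<Rightarrow> nat \<Rightarrow> nat \<Rightarrow> nat \<Rightarrow> (nat \<Rightarrow> real^'n::finite) \<Rightarrow> (nat \<Rightarrow> real)
   \<Rightarrow> (nat \<Rightarrow> nat \<Rightarrow> real) \<Rightarrow> (nat \<Rightarrow> real) \<Rightarrow> (nat \<Rightarrow> nat \<Rightarrow> real) \<Rightarrow> (nat \<Rightarrow> real)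
   \<Rightarrow> real^'n \<Rightarrow> real \<Rightarrow> real" where
  "spice_unnorm \<sigma> n K m W b A c B e x y =
     (let hid = encoder \<sigma> W b x;
          t = knots K (out_layer m A c hid);
          h = heights n (out_layer m B e hid)
      in spline_val n K t h y)"

end

theory Submission
  imports Defs
begin

text \<open>
  The core is the density theorem of Leshno, Lin, Pinkus and Schocken for a continuous
  non-polynomial activation \<open>\<sigma>\<close>. Let \<open>V\<close> be the uniform closure of the networks on a compact
  set. If \<open>q(x) G(w \<bullet> x + b)\<close> lies in \<open>V\<close> for all \<open>w\<close> and \<open>b\<close>, then so does
  \<open>(v \<bullet> x) q(x) (G(w \<bullet> x + b + h) - G(w \<bullet> x + b))\<close>: average \<open>G\<close> over a window of length \<open>h\<close> and
  differentiate in \<open>w\<close>. Starting from \<open>\<sigma>\<close> and setting \<open>w = 0\<close> at the end, every product of \<open>k\<close>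
  linear forms lies in \<open>V\<close> as soon as some \<open>k\<close>-fold difference of \<open>\<sigma>\<close> is nonzero somewhere, and
  otherwise \<open>\<sigma>\<close> would be a polynomial. Stone--Weierstrass finishes the argument.

  For the spline, constant network outputs give equally spaced knots. The heights are
  network approximations of \<open>f\<close> at the nodes, precomposed with the inverse of softplus at the
  knots after raising \<open>f\<close> to a positive function. On a short piece all heights are close to
  \<open>f(x, y)\<close>, and since the nodes are equispaced the Lebesgue constant of the interpolation
  depends only on the degree.
\<close>

subsection \<open>Lagrange interpolation\<close>

definition lagrange_basis :: "(nat \<Rightarrow> real) \<Rightarrow> nat \<Rightarrow> nat \<Rightarrow> real poly" where
  "lagrange_basis x N j = (\<Prod>i\<in>{..N} - {j}. smult (1 / (x j - x i)) [:- x i, 1:])"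

lemma poly_lagrange_basis:
  "poly (lagrange_basis x N j) y = (\<Prod>i\<in>{..N} - {j}. (y - x i) / (x j - x i))"
  unfolding lagrange_basis_def poly_prod by (intro prod.cong) (auto simp: field_simps diff_divide_distrib)

lemma degree_lagrange_basis:
  assumes "j \<le> N"
  shows "degree (lagrange_basis x N j) \<le> N"
proof -
  have "degree (lagrange_basis x N j) \<le> (\<Sum>i\<in>{..N} - {j}. degree (smult (1 / (x j - x i)) [:- x i, 1:]))"
    unfolding lagrange_basis_def 
    by (rule order.trans[OF degree_prod_sum_le]) (auto simp: o_def)
  also have "\<dots> \<le> (\<Sum>i\<in>{..N} - {j}. 1)"
    by (intro sum_mono order.trans[OF degree_smult_le]) simp
  also have "\<dots> = N"
    using assms by simp
  finally show ?thesis .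
qed

lemma lagrange_basis_node:
  assumes "inj_on x {..N}" "i \<le> N" "j \<le> N"
  shows "poly (lagrange_basis x N j) (x i) = (if i = j then 1 else 0)"
proof (cases "i = j")
  case True
  have "x k \<noteq> x j" if "k \<in> {..N} - {j}" for k
    using that assms by (auto dest: inj_onD)
  then show ?thesis
    using True by (force simp: poly_lagrange_basis intro!: prod.neutral)
next
  case False
  then have "i \<in> {..N} - {j}"
    using assms by auto
  then have "poly (lagrange_basis x N j) (x i) = 0"
    unfolding poly_lagrange_basis by (intro prod_zero) auto
  with False show ?thesis
    by simp
qed

definition lagrange_poly :: "(nat \<Rightarrow> real) \<Rightarrow> nat \<Rightarrow> (nat \<Rightarrow> real) \<Rightarrow> real poly" where
  "lagrange_poly x N h = (\<Sum>j\<le>N. smult (h j) (lagrange_basis x N j))"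

lemma poly_lagrange_poly:
  "poly (lagrange_poly x N h) y = (\<Sum>j\<le>N. h j * poly (lagrange_basis x N j) y)"
  by (simp add: lagrange_poly_def poly_sum)

lemma degree_lagrange_poly: "degree (lagrange_poly x N h) \<le> N"
  unfolding lagrange_poly_def
  by (intro degree_sum_le) (auto intro!: order.trans[OF degree_smult_le] degree_lagrange_basis)

lemma lagrange_poly_node:
  assumes "inj_on x {..N}" "i \<le> N"
  shows "poly (lagrange_poly x N h) (x i) = h i"
proof -
  have "poly (lagrange_poly x N h) (x i) = (\<Sum>k\<le>N. if k = i then h k else 0)"
    unfolding poly_lagrange_poly
    by (intro sum.cong refl) (use assms in \<open>auto simp: lagrange_basis_node\<close>)
  then show ?thesis
    using assms by simp
qed

text \<open>Two polynomials of degree at most \<open>N\<close> that agree at \<open>N + 1\<close>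
  distinct nodes coincide. This is what evaluates the definite description in
  \<open>piece_poly\<close>.\<close>

lemma lagrange_poly_unique:
  assumes "inj_on x {..N}" "degree p \<le> N" "\<And>j. j \<le> N \<Longrightarrow> poly p (x j) = h j"
  shows "p = lagrange_poly x N h"
proof (rule poly_eqI_degree[of "x ` {..N}"])
  have "card (x ` {..N}) = Suc N"
    using assms(1) by (simp add: card_image)
  then show "degree p < card (x ` {..N})" "degree (lagrange_poly x N h) < card (x ` {..N})"
    using assms(2) degree_lagrange_poly[of x N h] by auto
qed (use assms in \<open>auto simp: lagrange_poly_node\<close>)

text \<open>Uniqueness applied to the values of \<open>p\<close> itself. The right side is linear in
  these values, so it carries limits and error bounds from the nodes to all of the line.\<close>

lemma lagrange_expansion:
  assumes "inj_on x {..N}" "degree p \<le> N"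
  shows "poly p y = (\<Sum>j\<le>N. poly p (x j) * poly (lagrange_basis x N j) y)"
  using lagrange_poly_unique[OF assms refl] poly_lagrange_poly by metis

subsection \<open>Finite differences and polynomials\<close>

lemma ex_poly_antiderivative:
  fixes p :: "real poly"
  obtains q where "pderiv q = p" "degree q \<le> Suc (degree p)"
proof
  let ?q = "\<Sum>i\<le>degree p. monom (coeff p i / real (Suc i)) (Suc i)"
  have "pderiv ?q = (\<Sum>i\<le>degree p. pderiv (monom (coeff p i / real (Suc i)) (Suc i)))"
    by (rule higher_pderiv_sum[of 1, simplified])
  also have "\<dots> = (\<Sum>i\<le>degree p. monom (coeff p i) i)"
    by (intro sum.cong) (auto simp: pderiv_monom simp del: of_nat_Suc)
  also have "\<dots> = p"
    by (simp add: poly_as_sum_of_monoms)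
  finally show "pderiv ?q = p" .
  show "degree ?q \<le> Suc (degree p)"
    by (intro degree_sum_le) (auto intro!: order.trans[OF degree_monom_le])
qed

lemma ex_antiderivative_on_reals:
  fixes g :: "real \<Rightarrow> real"
  assumes "continuous_on UNIV g"
  obtains F where "\<And>u. (F has_real_derivative g u) (at u)"
proof -
  have "\<exists>F. \<forall>u::real. -\<infinity> < ereal u \<longrightarrow> ereal u < \<infinity> \<longrightarrow> (F has_vector_derivative g u) (at u)"
    by (rule einterval_antiderivative)
      (use assms in \<open>auto simp: continuous_on_eq_continuous_at\<close>)
  then show ?thesis
    using that by (auto simp: has_real_derivative_iff_has_vector_derivative)
qed

text \<open>The steps may differ from one difference to the next; in
  \<open>net_approximable_form_prod_diffs\<close> each of them is paired with one linear
  form.\<close>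

fun diffs :: "real list \<Rightarrow> (real \<Rightarrow> real) \<Rightarrow> real \<Rightarrow> real" where
  "diffs [] g = g"
| "diffs (h # hs) g = diffs hs (\<lambda>u. g (u + h) - g u)"

lemma continuous_on_shift_diff:
  fixes g :: "real \<Rightarrow> real"
  assumes "continuous_on UNIV g"
  shows "continuous_on UNIV (\<lambda>u. g (u + h) - g u)"
  by (intro continuous_intros continuous_on_compose2[OF assms]) auto

text \<open>A continuous function is the limit of the difference quotients of its antiderivative.
  These are polynomials of bounded degree, and Lagrange's formula turns pointwise convergence
  of such polynomials into convergence to a polynomial.\<close>

lemma poly_if_diffs_vanish:
  assumes "continuous_on UNIV g" "\<And>hs u. length hs = k \<Longrightarrow> diffs hs g u = 0"
  shows "\<exists>p. degree p \<le> k \<and> (\<forall>u. g u = poly p u)"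
  using assms
proof (induction k arbitrary: g)
  case 0
  then show ?case
    by (intro exI[of _ 0]) (use "0.prems"(2)[of "[]"] in auto)
next
  case (Suc k)
  obtain F where F: "\<And>u. (F has_real_derivative g u) (at u)"
    using ex_antiderivative_on_reals[OF Suc.prems(1)] by blast
  \<comment> \<open>The increment of \<open>F\<close> has derivative \<open>g (u + h) - g u\<close>,
    a polynomial by the induction hypothesis. Hence the increment is an antiderivative
    \<open>q\<close> of that polynomial plus a constant \<open>c\<close>.\<close>
  have "\<exists>p. degree p \<le> Suc k \<and> (\<forall>u. F (u + h) - F u = poly p u)" for h
  proof -
    obtain p where p: "degree p \<le> k" "\<And>u. g (u + h) - g u = poly p u"
      using Suc.IH[OF continuous_on_shift_diff[OF Suc.prems(1)], of h] Suc.prems(2)[of "h # hs" for hs]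
      by auto
    obtain q where q: "pderiv q = p" "degree q \<le> Suc (degree p)"
      using ex_poly_antiderivative by blast
    define c where "c = F (0 + h) - F 0 - poly q 0"
    have sh: "((\<lambda>u. F (u + h)) has_real_derivative g (u + h)) (at u)" for u
      using F[of "u + h"] DERIV_shift by blast
    have "((\<lambda>u. F (u + h) - F u - poly q u) has_real_derivative 0) (at u)" for u
      using DERIV_diff[OF DERIV_diff[OF sh F] poly_DERIV[of q], of u] p(2) q(1) by simp
    then have c: "F (u + h) - F u - poly q u = c" for u
      unfolding c_def using DERIV_isconst_all[of "\<lambda>u. F (u + h) - F u - poly q u" u 0] by blast
    have "F (u + h) - F u = poly (q + [:c:]) u" for u
      using c[of u] by simp
    moreover have "degree (q + [:c:]) \<le> Suc k"
      using p(1) q(2) by (intro degree_add_le) auto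
    ultimately show ?thesis
      by blast
  qed
  then obtain P where P: "\<And>h. degree (P h) \<le> Suc k" "\<And>h u. F (u + h) - F u = poly (P h) u"
    by metis
  \<comment> \<open>The degree bound does not depend on \<open>h\<close>, so the same
    \<open>k + 2\<close> nodes \<open>0, ..., k + 1\<close> determine every \<open>P h\<close>. As
    \<open>h\<close> tends to 0, the difference quotients at these nodes tend to the values of
    \<open>g\<close>.\<close>
  let ?p = "lagrange_poly real (Suc k) (\<lambda>j. g (real j))"
  have lim: "((\<lambda>h. (F (u + h) - F u) / h) \<longlongrightarrow> g u) (at 0)" for u
    using F[of u] by (simp add: DERIV_def)
  have "g u = poly ?p u" for u
  proof (rule tendsto_unique[OF _ lim])
    have "(F (u + h) - F u) / h
        = (\<Sum>j\<le>Suc k. (F (real j + h) - F (real j)) / h * poly (lagrange_basis real (Suc k) j) u)" for h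
      unfolding P(2) using lagrange_expansion[of real "Suc k" "P h" u] P(1)[of h]
      by (simp add: sum_divide_distrib add_divide_distrib inj_on_def del: sum.atMost_Suc)
    moreover have "((\<lambda>h. \<Sum>j\<le>Suc k. (F (real j + h) - F (real j)) / h * poly (lagrange_basis real (Suc k) j) u)
        \<longlongrightarrow> (\<Sum>j\<le>Suc k. g (real j) * poly (lagrange_basis real (Suc k) j) u)) (at 0)"
      by (intro tendsto_intros lim)
    ultimately show "((\<lambda>h. (F (u + h) - F u) / h) \<longlongrightarrow> poly ?p u) (at 0)"
      by (simp add: poly_lagrange_poly del: sum.atMost_Suc)
  qed simp
  with degree_lagrange_poly show ?case
    by blast
qed

section \<open>Uniform first-order expansions and Riemann sums\<close>

text \<open>By the mean value theorem the increment is \<open>s * g \<xi>\<close> with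
  \<open>\<xi>\<close> within \<open>\<bar>s\<bar>\<close> of \<open>u\<close>, and \<open>g\<close>
  is uniformly continuous on compact intervals. An error proportional to
  \<open>\<bar>s\<bar>\<close> survives both division by a step and summation over many
  steps.\<close>

lemma uniform_linear_approximation:
  fixes F g :: "real \<Rightarrow> real"
  assumes F: "\<And>u. (F has_real_derivative g u) (at u)"
    and g: "continuous_on UNIV g" and "\<epsilon> > 0"
  obtains \<delta> where "\<delta> > 0"
    "\<And>u s. \<bar>u\<bar> \<le> R \<Longrightarrow> \<bar>s\<bar> < \<delta> \<Longrightarrow> \<bar>F (u + s) - F u - s * g u\<bar> \<le> \<epsilon> * \<bar>s\<bar>"
proof -
  \<comment> \<open>The margin 1 keeps \<open>\<xi>\<close> inside the interval, since
    \<open>\<bar>s\<bar>\<close> will be less than 1.\<close>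
  have "uniformly_continuous_on {-(R+1)..R+1} g"
    by (intro compact_uniformly_continuous continuous_on_subset[OF g]) auto
  then obtain d where d: "d > 0"
    "\<And>u v. u \<in> {-(R+1)..R+1} \<Longrightarrow> v \<in> {-(R+1)..R+1} \<Longrightarrow> dist v u < d \<Longrightarrow> dist (g v) (g u) < \<epsilon>"
    using \<open>\<epsilon> > 0\<close> unfolding uniformly_continuous_on_def by metis
  have "\<bar>F (u + s) - F u - s * g u\<bar> \<le> \<epsilon> * \<bar>s\<bar>" if us: "\<bar>u\<bar> \<le> R" "\<bar>s\<bar> < min d 1" for u s
  proof -
    have "\<exists>\<xi>. \<bar>\<xi> - u\<bar> \<le> \<bar>s\<bar> \<and> F (u + s) - F u = s * g \<xi>"
    proof (cases s "0::real" rule: linorder_cases)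
      case greater
      then show ?thesis
        using MVT2[of u "u + s" F g] F by force
    next
      case less
      then obtain \<xi> where "u + s < \<xi>" "\<xi> < u" "F u - F (u + s) = (u - (u + s)) * g \<xi>"
        using MVT2[of "u + s" u F g] F by force
      then show ?thesis
        using less by (intro exI[of _ \<xi>]) (auto simp: algebra_simps)
    qed auto
    then obtain \<xi> where \<xi>: "\<bar>\<xi> - u\<bar> \<le> \<bar>s\<bar>" "F (u + s) - F u = s * g \<xi>"
      by blast
    have "dist (g \<xi>) (g u) < \<epsilon>"
      by (rule d(2)) (use \<xi>(1) us in \<open>auto simp: dist_real_def\<close>)
    then have "\<bar>s\<bar> * \<bar>g \<xi> - g u\<bar> \<le> \<bar>s\<bar> * \<epsilon>"
      by (intro mult_left_mono) (auto simp: dist_real_def)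
    moreover have "F (u + s) - F u - s * g u = s * (g \<xi> - g u)"
      using \<xi>(2) by (simp add: algebra_simps)
    ultimately show ?thesis
      by (simp add: abs_mult mult.commute)
  qed
  then show ?thesis
    using that[of "min d 1"] \<open>d > 0\<close> by auto
qed

text \<open>The increment of \<open>F\<close> telescopes over \<open>N\<close> steps of size
  \<open>h / N\<close>, and the first-order expansion is applied to each. The sign of
  \<open>h\<close> is arbitrary.\<close>

lemma uniform_riemann_sum:
  fixes F g :: "real \<Rightarrow> real"
  assumes F: "\<And>u. (F has_real_derivative g u) (at u)"
    and g: "continuous_on UNIV g" and "\<epsilon> > 0"
  obtains N where
    "\<And>u. \<bar>u\<bar> \<le> R \<Longrightarrow> \<bar>F (u + h) - F u - (\<Sum>i<N. h / real N * g (u + real i * (h / real N)))\<bar> \<le> \<epsilon>"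
proof -
  \<comment> \<open>The \<open>N\<close> errors add up to
    \<open>\<epsilon>' * \<bar>h\<bar>\<close>; the summand 1 covers \<open>h = 0\<close>.\<close>
  define \<epsilon>' where "\<epsilon>' = \<epsilon> / (\<bar>h\<bar> + 1)"
  have "\<epsilon>' > 0"
    using \<open>\<epsilon> > 0\<close> by (simp add: \<epsilon>'_def)
  \<comment> \<open>The sample points stray from \<open>u\<close> by at most
    \<open>\<bar>h\<bar>\<close>, hence the larger radius.\<close>
  then obtain \<delta> where \<delta>: "\<delta> > 0"
    "\<And>u s. \<bar>u\<bar> \<le> R + \<bar>h\<bar> \<Longrightarrow> \<bar>s\<bar> < \<delta> \<Longrightarrow> \<bar>F (u + s) - F u - s * g u\<bar> \<le> \<epsilon>' * \<bar>s\<bar>"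
    using uniform_linear_approximation[OF F g] by blast
  obtain N :: nat where N: "\<bar>h\<bar> / \<delta> < real N"
    using reals_Archimedean2 by blast
  have "real N > 0"
    using N \<delta>(1) by (smt (verit) divide_nonneg_pos)
  define s where "s = h / real N"
  have s: "\<bar>s\<bar> < \<delta>" "real N * s = h" "real N * \<bar>s\<bar> = \<bar>h\<bar>"
    using N \<open>real N > 0\<close> \<delta>(1) by (auto simp: s_def field_simps)
  have "\<bar>F (u + h) - F u - (\<Sum>i<N. s * g (u + real i * s))\<bar> \<le> \<epsilon>" if u: "\<bar>u\<bar> \<le> R" for u
  proof -
    have "F (u + h) - F u = (\<Sum>i<N. F (u + real (Suc i) * s) - F (u + real i * s))"
      using sum_lessThan_telescope[of "\<lambda>i. F (u + real i * s)" N] s(2) by simp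
    then have "F (u + h) - F u - (\<Sum>i<N. s * g (u + real i * s))
        = (\<Sum>i<N. F (u + real i * s + s) - F (u + real i * s) - s * g (u + real i * s))"
      by (simp add: sum_subtractf sum.distrib algebra_simps)
    also have "\<bar>\<dots>\<bar> \<le> (\<Sum>i<N. \<epsilon>' * \<bar>s\<bar>)"
    proof (intro order.trans[OF sum_abs] sum_mono \<delta>(2) s(1))
      fix i assume "i \<in> {..<N}"
      then have "real i * \<bar>s\<bar> \<le> real N * \<bar>s\<bar>"
        by (intro mult_right_mono) auto
      then have "\<bar>real i * s\<bar> \<le> \<bar>h\<bar>"
        using s(3) by (simp add: abs_mult)
      then show "\<bar>u + real i * s\<bar> \<le> R + \<bar>h\<bar>"
        using u by linarith
    qed
    also have "\<dots> = \<epsilon>' * \<bar>h\<bar>"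
      using s(3) by (simp add: mult.left_commute)
    also have "\<dots> \<le> \<epsilon>"
      using \<open>\<epsilon> > 0\<close> by (simp add: \<epsilon>'_def field_simps)
    finally show ?thesis .
  qed
  then show ?thesis
    using that[of N] by (simp add: s_def)
qed

subsection \<open>Density of single-hidden-layer networks\<close>

text \<open>Membership in the uniform closure, on \<open>S\<close>, of the span of all ridge units.
  Every tolerance may use its own hidden layer.\<close>

definition net_approximable ::
  "(real \<Rightarrow> real) \<Rightarrow> (real^'n::finite) set \<Rightarrow> (real^'n \<Rightarrow> real) \<Rightarrow> bool" where
  "net_approximable \<sigma> S g \<longleftrightarrow>
     (\<forall>\<epsilon>>0. \<exists>m W b a. \<forall>x\<in>S. \<bar>(\<Sum>j<m. a j * encoder \<sigma> W b x j) - g x\<bar> < \<epsilon>)"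

text \<open>The hidden layers are concatenated and the output weights padded with zeros. The merged
  \<open>W\<close> and \<open>b\<close> are chosen before \<open>a\<close>, so one hidden layer
  serves any number of output rows.\<close>

lemma merge_encoders:
  fixes W1 W2 :: "nat \<Rightarrow> real^'n::finite"
  obtains W b where
    "\<And>a x. (\<Sum>j<m1. a j * encoder \<sigma> W1 b1 x j)
       = (\<Sum>j<m1 + m2. (if j < m1 then a j else 0) * encoder \<sigma> W b x j)"
    "\<And>a x. (\<Sum>j<m2. a j * encoder \<sigma> W2 b2 x j)
       = (\<Sum>j<m1 + m2. (if j < m1 then 0 else a (j - m1)) * encoder \<sigma> W b x j)"
proof
  define W b where "W = (\<lambda>j. if j < m1 then W1 j else W2 (j - m1))"
    and "b = (\<lambda>j. if j < m1 then b1 j else b2 (j - m1))"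
  have split: "(\<Sum>j<m1 + m2. g j) = (\<Sum>j<m1. g j) + (\<Sum>j<m2. g (m1 + j))" for g :: "nat \<Rightarrow> real"
    using sum.atLeastLessThan_concat[of 0 m1 "m1 + m2" g] sum.shift_bounds_nat_ivl[of g 0 m1 m2]
    by (simp add: atLeast0LessThan add.commute)
  show "(\<Sum>j<m1. a j * encoder \<sigma> W1 b1 x j)
       = (\<Sum>j<m1 + m2. (if j < m1 then a j else 0) * encoder \<sigma> W b x j)" for a x
    by (simp add: split encoder_def W_def b_def)
  show "(\<Sum>j<m2. a j * encoder \<sigma> W2 b2 x j)
       = (\<Sum>j<m1 + m2. (if j < m1 then 0 else a (j - m1)) * encoder \<sigma> W b x j)" for a x
    by (simp add: split encoder_def W_def b_def)
qed

text \<open>A uniform closure is closed. This admits limits of Riemann sums, of difference quotients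
  and of Stone--Weierstrass polynomials.\<close>

lemma net_approximable_closed:
  assumes "\<And>\<epsilon>. \<epsilon> > 0 \<Longrightarrow> \<exists>g'. net_approximable \<sigma> S g' \<and> (\<forall>x\<in>S. \<bar>g' x - g x\<bar> \<le> \<epsilon>)"
  shows "net_approximable \<sigma> S g"
  unfolding net_approximable_def
proof (intro allI impI)
  fix \<epsilon> :: real assume "\<epsilon> > 0"
  then obtain g' where g': "net_approximable \<sigma> S g'" "\<forall>x\<in>S. \<bar>g' x - g x\<bar> \<le> \<epsilon> / 2"
    using assms[of "\<epsilon> / 2"] by auto
  obtain m W b a where "\<forall>x\<in>S. \<bar>(\<Sum>j<m. a j * encoder \<sigma> W b x j) - g' x\<bar> < \<epsilon> / 2"
    using g'(1) \<open>\<epsilon> > 0\<close> unfolding net_approximable_def by (meson half_gt_zero)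
  with g'(2) have "\<forall>x\<in>S. \<bar>(\<Sum>j<m. a j * encoder \<sigma> W b x j) - g x\<bar> < \<epsilon>"
    by (smt (verit) field_sum_of_halves)
  then show "\<exists>m W b a. \<forall>x\<in>S. \<bar>(\<Sum>j<m. a j * encoder \<sigma> W b x j) - g x\<bar> < \<epsilon>"
    by blast
qed

lemma net_approximable_zero: "net_approximable \<sigma> S (\<lambda>x. 0)"
  unfolding net_approximable_def by (auto intro!: exI[of _ 0])

lemma net_approximable_ridge: "net_approximable \<sigma> S (\<lambda>x. \<sigma> (w \<bullet> x + b))"
  unfolding net_approximable_def
proof (intro allI impI)
  fix \<epsilon> :: real assume "\<epsilon> > 0"
  then show "\<exists>m W b' a. \<forall>x\<in>S. \<bar>(\<Sum>j<m. a j * encoder \<sigma> W b' x j) - \<sigma> (w \<bullet> x + b)\<bar> < \<epsilon>"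
    by (intro exI[of _ 1] exI[of _ "\<lambda>_. w"] exI[of _ "\<lambda>_. b"] exI[of _ "\<lambda>_. 1"])
      (simp add: encoder_def)
qed

lemma net_approximable_add:
  fixes S :: "(real^'n::finite) set"
  assumes "net_approximable \<sigma> S g1" "net_approximable \<sigma> S g2"
  shows "net_approximable \<sigma> S (\<lambda>x. g1 x + g2 x)"
  unfolding net_approximable_def
proof (intro allI impI)
  fix \<epsilon> :: real assume "\<epsilon> > 0"
  then obtain m1 W1 b1 a1 m2 W2 b2 a2 where
    1: "\<forall>x\<in>S. \<bar>(\<Sum>j<m1. a1 j * encoder \<sigma> W1 b1 x j) - g1 x\<bar> < \<epsilon> / 2" and
    2: "\<forall>x\<in>S. \<bar>(\<Sum>j<m2. a2 j * encoder \<sigma> W2 b2 x j) - g2 x\<bar> < \<epsilon> / 2"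
    using assms unfolding net_approximable_def by (meson half_gt_zero)
  obtain W b where
    3: "\<And>a x. (\<Sum>j<m1. a j * encoder \<sigma> W1 b1 x j)
       = (\<Sum>j<m1 + m2. (if j < m1 then a j else 0) * encoder \<sigma> W b x j)" and
    4: "\<And>a x. (\<Sum>j<m2. a j * encoder \<sigma> W2 b2 x j)
       = (\<Sum>j<m1 + m2. (if j < m1 then 0 else a (j - m1)) * encoder \<sigma> W b x j)"
    using merge_encoders[of \<sigma> W1 b1 m1 m2 W2 b2] by blast
  let ?a = "\<lambda>j. (if j < m1 then a1 j else 0) + (if j < m1 then 0 else a2 (j - m1))"
  have "(\<Sum>j<m1 + m2. ?a j * encoder \<sigma> W b x j)
      = (\<Sum>j<m1. a1 j * encoder \<sigma> W1 b1 x j) + (\<Sum>j<m2. a2 j * encoder \<sigma> W2 b2 x j)" for x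
    unfolding 3 4 by (simp only: distrib_right sum.distrib)
  then have "\<forall>x\<in>S. \<bar>(\<Sum>j<m1 + m2. ?a j * encoder \<sigma> W b x j) - (g1 x + g2 x)\<bar> < \<epsilon>"
    using 1 2 by (smt (verit) field_sum_of_halves)
  then show "\<exists>m W b a. \<forall>x\<in>S. \<bar>(\<Sum>j<m. a j * encoder \<sigma> W b x j) - (g1 x + g2 x)\<bar> < \<epsilon>"
    by (intro exI[of _ "m1 + m2"] exI[of _ W] exI[of _ b] exI[of _ ?a])
qed

lemma net_approximable_scale:
  assumes "net_approximable \<sigma> S g"
  shows "net_approximable \<sigma> S (\<lambda>x. c * g x)"
  unfolding net_approximable_def
proof (intro allI impI)
  fix \<epsilon> :: real assume "\<epsilon> > 0"
  then obtain m W b a where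
    *: "\<forall>x\<in>S. \<bar>(\<Sum>j<m. a j * encoder \<sigma> W b x j) - g x\<bar> < \<epsilon> / (\<bar>c\<bar> + 1)"
    using assms unfolding net_approximable_def
    by (metis abs_ge_zero divide_pos_pos add_nonneg_pos zero_less_one)
  have "\<bar>(\<Sum>j<m. (c * a j) * encoder \<sigma> W b x j) - c * g x\<bar> < \<epsilon>" if "x \<in> S" for x
  proof -
    have eq: "(\<Sum>j<m. (c * a j) * encoder \<sigma> W b x j) - c * g x
        = c * ((\<Sum>j<m. a j * encoder \<sigma> W b x j) - g x)"
      by (simp add: sum_distrib_left algebra_simps)
    have "\<bar>(\<Sum>j<m. (c * a j) * encoder \<sigma> W b x j) - c * g x\<bar>
        \<le> \<bar>c\<bar> * (\<epsilon> / (\<bar>c\<bar> + 1))"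
      unfolding eq abs_mult using * that by (intro mult_left_mono) (auto intro: less_imp_le)
    also have "\<dots> < \<epsilon>"
      using \<open>\<epsilon> > 0\<close> by (simp add: field_simps)
    finally show ?thesis .
  qed
  then show "\<exists>m W b a. \<forall>x\<in>S. \<bar>(\<Sum>j<m. a j * encoder \<sigma> W b x j) - c * g x\<bar> < \<epsilon>"
    by (intro exI[of _ m] exI[of _ W] exI[of _ b] exI[of _ "\<lambda>j. c * a j"]) blast
qed

lemma net_approximable_sum:
  assumes "\<And>i. i \<in> I \<Longrightarrow> net_approximable \<sigma> S (g i)"
  shows "net_approximable \<sigma> S (\<lambda>x. \<Sum>i\<in>I. g i x)"
  using assms
  by (induction I rule: infinite_finite_induct)
    (auto intro: net_approximable_zero net_approximable_add)

text \<open>\<open>\<integral>\<^sub>0\<^sup>h G (u + s) ds\<close> is a uniform limit of sums of translates of \<open>G\<close>, so it may replace \<open>G\<close>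
  here; differentiating \<open>w \<mapsto> \<integral>\<^sub>0\<^sup>h G (w \<bullet> x + b + s) ds\<close> in direction \<open>v\<close> then brings out the
  factor \<open>v \<bullet> x\<close> and turns the integral into a difference of \<open>G\<close>.\<close>

lemma net_approximable_mult_linear_form:
  fixes S :: "(real^'n::finite) set"
  assumes S: "bounded S" and q: "bounded (q ` S)" and G: "continuous_on UNIV G"
    and approx: "\<And>w b. net_approximable \<sigma> S (\<lambda>x. q x * G (w \<bullet> x + b))"
  shows "net_approximable \<sigma> S (\<lambda>x. (v \<bullet> x * q x) * (G (w \<bullet> x + b + h) - G (w \<bullet> x + b)))"
proof -
  obtain F where F: "\<And>u. (F has_real_derivative G u) (at u)"
    using ex_antiderivative_on_reals[OF G] by blast
  define \<Phi> where "\<Phi> = (\<lambda>u. F (u + h) - F u)"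
  have F_shift: "((\<lambda>u. F (u + h)) has_real_derivative G (u + h)) (at u)" for u
    using F[of "u + h"] DERIV_shift by blast
  have \<Phi>: "(\<Phi> has_real_derivative G (u + h) - G u) (at u)" for u
    unfolding \<Phi>_def by (rule DERIV_diff[OF F_shift F])
  obtain C where C: "\<And>x. x \<in> S \<Longrightarrow> norm x \<le> C" "C > 0"
    using S by (meson bounded_pos)
  obtain Q where Q: "\<And>x. x \<in> S \<Longrightarrow> \<bar>q x\<bar> \<le> Q" "Q > 0"
    using q by (auto simp: bounded_pos)
  have inner_le: "\<bar>z \<bullet> x\<bar> \<le> norm z * C" if "x \<in> S" for z x
    using Cauchy_Schwarz_ineq2[of z x] C(1)[OF that]
    by (smt (verit) mult_left_mono norm_ge_zero)
  \<comment> \<open>The Riemann sums of the integral of \<open>G\<close> change only the bias, so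
    their terms are covered by \<open>approx\<close> with the same \<open>w\<close>.\<close>
  have \<Phi>_approx: "net_approximable \<sigma> S (\<lambda>x. q x * \<Phi> (w \<bullet> x + b))" for w b
  proof (rule net_approximable_closed)
    fix \<epsilon> :: real assume "\<epsilon> > 0"
    with Q(2) have "\<epsilon> / Q > 0"
      by simp
    then obtain N where N: "\<And>u. \<bar>u\<bar> \<le> norm w * C + \<bar>b\<bar> \<Longrightarrow>
      \<bar>F (u + h) - F u - (\<Sum>i<N. h / real N * G (u + real i * (h / real N)))\<bar> \<le> \<epsilon> / Q"
      using uniform_riemann_sum[OF F G] by metis
    let ?g = "\<lambda>x. \<Sum>i<N. h / real N * (q x * G (w \<bullet> x + (b + real i * (h / real N))))"
    have "net_approximable \<sigma> S ?g"
      by (intro net_approximable_sum net_approximable_scale approx)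
    moreover have "\<bar>?g x - q x * \<Phi> (w \<bullet> x + b)\<bar> \<le> \<epsilon>" if "x \<in> S" for x
    proof -
      let ?u = "w \<bullet> x + b"
      have "\<bar>?u\<bar> \<le> norm w * C + \<bar>b\<bar>"
        using inner_le[OF that, of w] by linarith
      note N[OF this]
      then have "\<bar>q x\<bar> * \<bar>\<Phi> ?u - (\<Sum>i<N. h / real N * G (?u + real i * (h / real N)))\<bar> \<le> Q * (\<epsilon> / Q)"
        using Q(1)[OF that] Q(2) unfolding \<Phi>_def by (intro mult_mono) auto
      moreover have "?g x - q x * \<Phi> ?u
          = - (q x * (\<Phi> ?u - (\<Sum>i<N. h / real N * G (?u + real i * (h / real N)))))"
        by (simp add: right_diff_distrib sum_distrib_left mult_ac add.assoc)
      ultimately show ?thesis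
        using Q(2) by (simp add: abs_mult)
    qed
    ultimately show "\<exists>g'. net_approximable \<sigma> S g' \<and> (\<forall>x\<in>S. \<bar>g' x - q x * \<Phi> (w \<bullet> x + b)\<bar> \<le> \<epsilon>)"
      by blast
  qed
  show ?thesis
  proof (rule net_approximable_closed)
    fix \<epsilon> :: real assume "\<epsilon> > 0"
    \<comment> \<open>The summand 1 makes \<open>V\<close> positive even for
      \<open>v = 0\<close>.\<close>
    define V where "V = norm v * C + 1"
    have V: "V > 0" "\<And>x. x \<in> S \<Longrightarrow> \<bar>v \<bullet> x\<bar> \<le> V"
      using C(2) inner_le[of _ v] by (auto simp: V_def add_nonneg_pos intro: add_increasing2)
    \<comment> \<open>This tolerance is later multiplied by at most \<open>\<eta> * V\<close> and by
      \<open>Q\<close>, then divided by \<open>\<eta>\<close>, which leaves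
      \<open>\<epsilon>\<close>.\<close>
    have "\<epsilon> / (Q * V) > 0"
      using \<open>\<epsilon> > 0\<close> Q(2) V(1) by simp
    then obtain \<delta> where \<delta>: "\<delta> > 0" "\<And>u s. \<bar>u\<bar> \<le> norm w * C + \<bar>b\<bar> \<Longrightarrow> \<bar>s\<bar> < \<delta> \<Longrightarrow>
      \<bar>\<Phi> (u + s) - \<Phi> u - s * (G (u + h) - G u)\<bar> \<le> \<epsilon> / (Q * V) * \<bar>s\<bar>"
      using uniform_linear_approximation[OF \<Phi> continuous_on_shift_diff[OF G]] by metis
    \<comment> \<open>On \<open>S\<close> the displacement \<open>\<eta> * (v \<bullet> x)\<close>
      is then at most \<open>\<delta> / 2\<close> in absolute value.\<close>
    define \<eta> where "\<eta> = \<delta> / (2 * V)"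
    have "\<eta> > 0"
      using \<delta>(1) V(1) by (simp add: \<eta>_def)
    \<comment> \<open>The difference quotient of
      \<open>w \<mapsto> q x * \<Phi> (w \<bullet> x + b)\<close> in direction
      \<open>v\<close>.\<close>
    let ?g = "\<lambda>x. 1 / \<eta> * (q x * \<Phi> ((w + \<eta> *\<^sub>R v) \<bullet> x + b)) + (- 1 / \<eta>) * (q x * \<Phi> (w \<bullet> x + b))"
    have "net_approximable \<sigma> S ?g"
      by (intro net_approximable_add net_approximable_scale \<Phi>_approx)
    moreover have "\<bar>?g x - (v \<bullet> x * q x) * (G (w \<bullet> x + b + h) - G (w \<bullet> x + b))\<bar> \<le> \<epsilon>"
      if "x \<in> S" for x
    proof -
      let ?u = "w \<bullet> x + b" and ?s = "\<eta> * (v \<bullet> x)"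
      have abs_s: "\<bar>?s\<bar> = \<eta> * \<bar>v \<bullet> x\<bar>"
        using \<open>\<eta> > 0\<close> by (simp add: abs_mult)
      also have "\<dots> \<le> \<eta> * V"
        using V(2)[OF that] \<open>\<eta> > 0\<close> by simp
      also have "\<dots> < \<delta>"
        using V(1) \<delta>(1) by (simp add: \<eta>_def)
      finally have s: "\<bar>?s\<bar> < \<delta>" .
      have "\<bar>?u\<bar> \<le> norm w * C + \<bar>b\<bar>"
        using inner_le[OF that, of w] by linarith
      note \<delta>(2)[OF this s]
      also have "\<epsilon> / (Q * V) * \<bar>?s\<bar> \<le> \<epsilon> / (Q * V) * (\<eta> * V)"
        unfolding abs_s using V(2)[OF that] \<open>\<eta> > 0\<close> \<open>\<epsilon> / (Q * V) > 0\<close> by (intro mult_left_mono) auto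
      also have "\<dots> = \<epsilon> * \<eta> / Q"
        using V(1) Q(2) by (simp add: field_simps)
      finally have "\<bar>q x\<bar> * \<bar>\<Phi> (?u + ?s) - \<Phi> ?u - ?s * (G (?u + h) - G ?u)\<bar> \<le> Q * (\<epsilon> * \<eta> / Q)"
        using Q(1)[OF that] Q(2) by (intro mult_mono) auto
      also have "\<dots> = \<epsilon> * \<eta>"
        using Q(2) by simp
      finally have *: "\<bar>q x * (\<Phi> (?u + ?s) - \<Phi> ?u - ?s * (G (?u + h) - G ?u))\<bar> / \<eta> \<le> \<epsilon>"
        using \<open>\<eta> > 0\<close> by (simp add: abs_mult pos_divide_le_eq)
      have u': "(w + \<eta> *\<^sub>R v) \<bullet> x + b = ?u + ?s"
        by (simp add: inner_add_left)
      have "?g x - (v \<bullet> x * q x) * (G (?u + h) - G ?u)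
          = q x * (\<Phi> (?u + ?s) - \<Phi> ?u - ?s * (G (?u + h) - G ?u)) / \<eta>"
        unfolding u' using \<open>\<eta> > 0\<close> by (simp add: diff_divide_distrib right_diff_distrib mult_ac)
      also have "\<bar>\<dots>\<bar> \<le> \<epsilon>"
        using * \<open>\<eta> > 0\<close> by (simp add: abs_mult)
      finally show ?thesis .
    qed
    ultimately show "\<exists>g'. net_approximable \<sigma> S g' \<and>
        (\<forall>x\<in>S. \<bar>g' x - (v \<bullet> x * q x) * (G (w \<bullet> x + b + h) - G (w \<bullet> x + b))\<bar> \<le> \<epsilon>)"
      by blast
  qed
qed

section \<open>Products of linear forms and polynomial functions\<close>

definition form_prod :: "(real^'n::finite) list \<Rightarrow> real^'n \<Rightarrow> real" where
  "form_prod vs x = (\<Prod>v\<leftarrow>vs. v \<bullet> x)"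

lemma bounded_form_prod:
  assumes "bounded S"
  shows "bounded (form_prod vs ` S)"
proof (induction vs)
  case Nil
  then show ?case
    by (auto simp: form_prod_def bounded_iff)
next
  case (Cons v vs)
  obtain C D where C: "\<And>x. x \<in> S \<Longrightarrow> norm x \<le> C" and D: "\<And>x. x \<in> S \<Longrightarrow> \<bar>form_prod vs x\<bar> \<le> D"
    using assms Cons by (auto simp: bounded_iff)
  have "norm (form_prod (v # vs) x) \<le> norm v * C * D" if "x \<in> S" for x
  proof -
    have "\<bar>v \<bullet> x\<bar> \<le> norm v * C"
      using Cauchy_Schwarz_ineq2[of v x] C[OF that] by (smt (verit) mult_left_mono norm_ge_zero)
    then have "\<bar>v \<bullet> x\<bar> * \<bar>form_prod vs x\<bar> \<le> norm v * C * D"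
      using D[OF that] by (intro mult_mono) auto
    then show ?thesis
      by (simp add: form_prod_def abs_mult)
  qed
  then show ?case
    by (auto simp: bounded_iff)
qed

text \<open>Each round of \<open>net_approximable_mult_linear_form\<close> moves one form into the
  accumulator \<open>us\<close> and replaces \<open>G\<close> by one of its differences; the
  accumulator reverses \<open>vs\<close>.\<close>

lemma net_approximable_form_prod_diffs:
  fixes S :: "(real^'n::finite) set"
  assumes S: "bounded S" and "length vs = length hs" and "continuous_on UNIV G"
    and "\<And>w b. net_approximable \<sigma> S (\<lambda>x. form_prod us x * G (w \<bullet> x + b))"
  shows "net_approximable \<sigma> S (\<lambda>x. form_prod (rev vs @ us) x * diffs hs G (w \<bullet> x + b))"
  using assms(2-)
proof (induction vs hs arbitrary: us G rule: list_induct2)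
  case Nil
  then show ?case
    by simp
next
  case (Cons v vs h hs)
  have "net_approximable \<sigma> S
      (\<lambda>x. form_prod (v # us) x * (G (w \<bullet> x + b + h) - G (w \<bullet> x + b)))" for w b
    using net_approximable_mult_linear_form[OF S bounded_form_prod[OF S] Cons.prems]
    by (simp add: form_prod_def)
  from Cons.IH[OF continuous_on_shift_diff[OF Cons.prems(1)] this] show ?case
    by simp
qed

text \<open>As \<open>\<sigma>\<close> is not a polynomial, some difference of order
  \<open>length vs\<close> is nonzero at some \<open>b\<close>. Taking the direction 0 freezes the
  ridge factor at this nonzero constant, which is divided out.\<close>

lemma net_approximable_form_prod:
  fixes S :: "(real^'n::finite) set"
  assumes "bounded S" and \<sigma>: "continuous_on UNIV \<sigma>"
    and nonpoly: "\<not> (\<exists>p :: real poly. \<forall>u. \<sigma> u = poly p u)"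
  shows "net_approximable \<sigma> S (form_prod vs)"
proof -
  obtain hs b where hs: "length hs = length vs" "diffs hs \<sigma> b \<noteq> 0"
    using poly_if_diffs_vanish[OF \<sigma>] nonpoly by metis
  have "net_approximable \<sigma> S (\<lambda>x. form_prod (rev (rev vs) @ []) x * diffs hs \<sigma> (0 \<bullet> x + b))"
    by (rule net_approximable_form_prod_diffs)
      (use assms hs in \<open>auto simp: form_prod_def intro: net_approximable_ridge\<close>)
  from net_approximable_scale[OF this, of "1 / diffs hs \<sigma> b"] show ?thesis
    using hs(2) by simp
qed

text \<open>Polynomial functions in expanded form; the empty list gives the constants. Expansion is
  wanted because approximability is known to respect sums and scalar multiples, but not
  products.\<close>

inductive form_poly :: "(real^'n::finite \<Rightarrow> real) \<Rightarrow> bool" where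
  form_poly_prod: "form_poly (\<lambda>x. c * form_prod vs x)"
| form_poly_add: "form_poly p \<Longrightarrow> form_poly q \<Longrightarrow> form_poly (\<lambda>x. p x + q x)"

lemma form_poly_mult:
  assumes "form_poly p" "form_poly q"
  shows "form_poly (\<lambda>x. p x * q x)"
  using assms
proof (induction p)
  case (form_poly_prod c vs)
  then show ?case
  proof (induction q)
    case (form_poly_prod c' vs')
    have "(\<lambda>x. c * form_prod vs x * (c' * form_prod vs' x)) = (\<lambda>x. (c * c') * form_prod (vs @ vs') x)"
      by (auto simp: form_prod_def)
    then show ?case
      by (metis form_poly.form_poly_prod)
  next
    case (form_poly_add p q)
    then show ?case
      by (simp add: distrib_left form_poly.form_poly_add)
  qed
next
  case (form_poly_add p q)
  then show ?case
    by (simp add: distrib_right form_poly.form_poly_add)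
qed

lemma form_poly_real_polynomial_function:
  fixes p :: "real^'n::finite \<Rightarrow> real"
  assumes "real_polynomial_function p"
  shows "form_poly p"
  using assms
proof (induction p)
  case (linear f)
  \<comment> \<open>Riesz representation: the adjoint of a functional sends 1 to its representing
    vector.\<close>
  then have "f x = adjoint f 1 \<bullet> x" for x
    using adjoint_works[of f x 1] by (simp add: bounded_linear.linear inner_commute)
  then have "f = (\<lambda>x. 1 * form_prod [adjoint f 1] x)"
    by (auto simp: form_prod_def)
  then show ?case
    by (metis form_poly_prod)
next
  case (const c)
  show ?case
    using form_poly_prod[of c "[]"] by (simp add: form_prod_def)
qed (auto intro: form_poly_add form_poly_mult)

theorem net_approximable_continuous:
  fixes S :: "(real^'n::finite) set"
  assumes S: "compact S" and \<sigma>: "continuous_on UNIV \<sigma>"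
    and nonpoly: "\<not> (\<exists>p :: real poly. \<forall>u. \<sigma> u = poly p u)"
    and g: "continuous_on S g"
  shows "net_approximable \<sigma> S g"
proof (rule net_approximable_closed)
  fix \<epsilon> :: real assume "\<epsilon> > 0"
  then obtain p where p: "real_polynomial_function p" "\<And>x. x \<in> S \<Longrightarrow> \<bar>g x - p x\<bar> < \<epsilon>"
    using Stone_Weierstrass_real_polynomial_function[OF S g] by blast
  have "net_approximable \<sigma> S p"
    using form_poly_real_polynomial_function[OF p(1)]
  proof induction
    case (form_poly_prod c vs)
    show ?case
      by (intro net_approximable_scale net_approximable_form_prod compact_imp_bounded S \<sigma> nonpoly)
  qed (rule net_approximable_add)
  then show "\<exists>g'. net_approximable \<sigma> S g' \<and> (\<forall>x\<in>S. \<bar>g' x - g x\<bar> \<le> \<epsilon>)"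
    using p(2) by (intro exI[of _ p]) (auto simp: abs_minus_commute intro: less_imp_le)
qed

section \<open>Networks with several outputs\<close>

text \<open>All heights must share one encoder. Each new target appends its own hidden units, to
  which the earlier rows give weight zero.\<close>

lemma simultaneous_net_approximation:
  fixes S :: "(real^'n::finite) set"
  assumes g: "\<And>i. i < N \<Longrightarrow> net_approximable \<sigma> S (g i)" and "\<epsilon> > 0"
  shows "\<exists>m W b B. \<forall>i<N. \<forall>x\<in>S. \<bar>out_layer m B (\<lambda>_. 0) (encoder \<sigma> W b x) i - g i x\<bar> < \<epsilon>"
  using g
proof (induction N)
  case 0
  then show ?case
    by simp
next
  case (Suc N)
  from Suc obtain m1 W1 b1 B where
    1: "\<And>i x. i < N \<Longrightarrow> x \<in> S \<Longrightarrow> \<bar>out_layer m1 B (\<lambda>_. 0) (encoder \<sigma> W1 b1 x) i - g i x\<bar> < \<epsilon>"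
    by (metis less_SucI)
  obtain m2 W2 b2 a where
    2: "\<And>x. x \<in> S \<Longrightarrow> \<bar>(\<Sum>j<m2. a j * encoder \<sigma> W2 b2 x j) - g N x\<bar> < \<epsilon>"
    using Suc.prems[of N] \<open>\<epsilon> > 0\<close> unfolding net_approximable_def by (metis lessI)
  obtain W b where
    3: "\<And>a x. (\<Sum>j<m1. a j * encoder \<sigma> W1 b1 x j)
       = (\<Sum>j<m1 + m2. (if j < m1 then a j else 0) * encoder \<sigma> W b x j)" and
    4: "\<And>a x. (\<Sum>j<m2. a j * encoder \<sigma> W2 b2 x j)
       = (\<Sum>j<m1 + m2. (if j < m1 then 0 else a (j - m1)) * encoder \<sigma> W b x j)"
    using merge_encoders[of \<sigma> W1 b1 m1 m2 W2 b2] by blast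
  let ?B = "\<lambda>i j. if i = N then (if j < m1 then 0 else a (j - m1)) else (if j < m1 then B i j else 0)"
  have "\<bar>out_layer (m1 + m2) ?B (\<lambda>_. 0) (encoder \<sigma> W b x) i - g i x\<bar> < \<epsilon>"
    if "i < Suc N" "x \<in> S" for i x
  proof (cases "i = N")
    case True
    with 2[OF that(2)] show ?thesis
      unfolding 4 by (simp add: out_layer_def)
  next
    case False
    with that 1[of i x] show ?thesis
      unfolding out_layer_def 3 by simp
  qed
  then show ?case
    by (intro exI[of _ "m1 + m2"] exI[of _ W] exI[of _ b] exI[of _ ?B]) blast
qed

subsection \<open>Splines with equally spaced knots\<close>

text \<open>In each of the \<open>n\<close> factors the numerator is at most \<open>n * s\<close>
  and the denominator at least \<open>s\<close>, so the spacing cancels.\<close>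

lemma abs_lagrange_basis_equispaced_le:
  fixes s a y :: real
  assumes "s > 0" and y: "a \<le> y" "y \<le> a + real n * s" and "j \<le> n"
  shows "\<bar>poly (lagrange_basis (\<lambda>i. a + real i * s) n j) y\<bar> \<le> real n ^ n"
proof -
  have "\<bar>(y - (a + real i * s)) / ((a + real j * s) - (a + real i * s))\<bar> \<le> real n"
    if "i \<in> {..n} - {j}" for i
  proof -
    have "1 \<le> \<bar>real j - real i\<bar>"
      using that by (auto simp: abs_if)
    then have "s \<le> \<bar>real j - real i\<bar> * s"
      using \<open>s > 0\<close> by simp
    also have "\<dots> = \<bar>(a + real j * s) - (a + real i * s)\<bar>"
      using \<open>s > 0\<close> by (simp add: abs_mult flip: left_diff_distrib)
    finally have denom: "s \<le> \<bar>(a + real j * s) - (a + real i * s)\<bar>" .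
    have "0 \<le> real i * s" "real i * s \<le> real n * s"
      using that \<open>s > 0\<close> by (auto intro: mult_right_mono)
    then have "\<bar>y - (a + real i * s)\<bar> \<le> real n * s"
      using y by linarith
    then have "\<bar>y - (a + real i * s)\<bar> / \<bar>(a + real j * s) - (a + real i * s)\<bar> \<le> real n * s / s"
      using denom \<open>s > 0\<close> by (intro frac_le) auto
    then show ?thesis
      using \<open>s > 0\<close> by (simp add: abs_divide)
  qed
  then have "(\<Prod>i\<in>{..n} - {j}. \<bar>(y - (a + real i * s)) / ((a + real j * s) - (a + real i * s))\<bar>)
      \<le> (\<Prod>i\<in>{..n} - {j}. real n)"
    by (intro prod_mono) auto
  also have "\<dots> = real n ^ n"
    using \<open>j \<le> n\<close> by simp
  finally show ?thesis
    by (simp add: poly_lagrange_basis abs_prod)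
qed

text \<open>The Lagrange expansion of \<open>p - [:v:]\<close> has \<open>n + 1\<close> terms, each
  at most \<open>\<delta> * n ^ n\<close>.\<close>

lemma equispaced_interpolation_near_constant:
  fixes s a y :: real
  assumes "s > 0" and y: "a \<le> y" "y \<le> a + real n * s" and p: "degree p \<le> n"
    and close: "\<And>j. j \<le> n \<Longrightarrow> \<bar>poly p (a + real j * s) - v\<bar> \<le> \<delta>"
  shows "\<bar>poly p y - v\<bar> \<le> real (Suc n) * real n ^ n * \<delta>"
proof -
  let ?x = "\<lambda>i. a + real i * s"
  have inj: "inj_on ?x {..n}"
    using \<open>s > 0\<close> by (auto simp: inj_on_def)
  have "degree (p - [:v:]) \<le> n"
    using p by (intro degree_diff_le) auto
  from lagrange_expansion[OF inj this, of y]
  have "poly p y - v = (\<Sum>j\<le>n. (poly p (?x j) - v) * poly (lagrange_basis ?x n j) y)"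
    by simp
  also have "\<bar>\<dots>\<bar> \<le> (\<Sum>j\<le>n. \<delta> * real n ^ n)"
    by (intro order.trans[OF sum_abs] sum_mono)
      (use assms in \<open>auto simp: abs_mult intro!: mult_mono abs_lagrange_basis_equispaced_le
        intro: order.trans[OF abs_ge_zero close[of 0]]\<close>)
  finally show ?thesis
    by (simp add: mult_ac)
qed

lemma knots_zero: "knots (Suc M) (\<lambda>_. 0) i = real i / real M"
  by (simp add: knots_def knot_width_def)

text \<open>The last bound is not strict because \<open>y = 1\<close> belongs to the last
  piece.\<close>

lemma piece_index_uniform:
  assumes "M \<ge> 1" and y: "y \<in> {0..1}"
  defines "l \<equiv> piece_index (Suc M) (\<lambda>i. real i / real M) y"
  shows "l < M" "real l / real M \<le> y" "y \<le> (real l + 1) / real M"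
proof -
  let ?I = "{i. i < Suc M - 1 \<and> real i / real M \<le> y}"
  have "0 \<in> ?I" "finite ?I"
    using assms by auto
  then have l: "l \<in> ?I" "\<And>i. i \<in> ?I \<Longrightarrow> i \<le> l"
    unfolding l_def piece_index_def using Max_in[of ?I] Max_ge[of ?I] by blast+
  then show "l < M" "real l / real M \<le> y"
    by auto
  show "y \<le> (real l + 1) / real M"
  proof (rule ccontr)
    assume *: "\<not> y \<le> (real l + 1) / real M"
    then have "(real l + 1) / real M < 1"
      using y by auto
    then have "Suc l < M"
      using \<open>M \<ge> 1\<close> by (simp add: field_simps)
    with * have "Suc l \<in> ?I"
      by (auto simp: add.commute)
    with l(2) show False
      by fastforce
  qed
qed

text \<open>Node \<open>j\<close> of piece \<open>l\<close> is the global node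
  \<open>(l * n + j) / (n * M)\<close>, and all nodes of the piece containing \<open>y\<close> lie
  within \<open>1 / M\<close> of \<open>y\<close>. Truncation at 0 cannot increase the distance to
  \<open>v \<ge> 0\<close>.\<close>

lemma spline_val_uniform_close:
  assumes "n \<ge> 1" "M \<ge> 1" and y: "y \<in> {0..1}"
    and close: "\<And>g. g \<le> n * M \<Longrightarrow> \<bar>real g / real (n * M) - y\<bar> \<le> 1 / real M \<Longrightarrow> \<bar>h g - v\<bar> \<le> \<delta>"
    and "v \<ge> 0"
  shows "\<bar>spline_val n (Suc M) (\<lambda>i. real i / real M) h y - v\<bar> \<le> real (Suc n) * real n ^ n * \<delta>"
proof -
  let ?t = "\<lambda>i. real i / real M"
  define l where "l = piece_index (Suc M) ?t y"
  define s where "s = 1 / real (n * M)"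
  define a where "a = real l / real M"
  note l = piece_index_uniform[OF \<open>M \<ge> 1\<close> y, folded l_def]
  have "s > 0" and ns: "real n * s = 1 / real M"
    using assms by (auto simp: s_def)
  have tau: "tau ?t n l = (\<lambda>j. a + real j * s)"
    using assms by (auto simp: tau_def a_def s_def field_simps)
  define p where "p = piece_poly n ?t h l"
  have inj: "inj_on (\<lambda>j. a + real j * s) {..n}"
    using \<open>s > 0\<close> by (auto simp: inj_on_def)
  let ?L = "lagrange_poly (\<lambda>j. a + real j * s) n (\<lambda>j. h (l * n + j))"
  have L: "poly ?L (a + real j * s) = h (l * n + j)" if "j \<le> n" for j
    using lagrange_poly_node[OF inj that] .
  have p_eq: "p = ?L"
    unfolding p_def piece_poly_def tau
    by (intro the_equality)
      (auto intro: lagrange_poly_unique[OF inj] degree_lagrange_poly simp: L)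
  have p: "degree p \<le> n" "\<And>j. j \<le> n \<Longrightarrow> poly p (a + real j * s) = h (l * n + j)"
    by (auto simp: p_eq degree_lagrange_poly L)
  have y_bounds: "a \<le> y" "y \<le> a + real n * s"
    using l(2,3) by (auto simp: a_def ns add_divide_distrib)
  have "\<bar>poly p y - v\<bar> \<le> real (Suc n) * real n ^ n * \<delta>"
  proof (rule equispaced_interpolation_near_constant[OF \<open>s > 0\<close> y_bounds p(1)])
    fix j assume "j \<le> n"
    have "l * n + j \<le> Suc l * n"
      using \<open>j \<le> n\<close> by simp
    also have "\<dots> \<le> n * M"
      using l(1) by (metis Suc_leI mult.commute mult_le_mono1)
    finally have "l * n + j \<le> n * M" .
    moreover have "real (l * n + j) / real (n * M) = a + real j * s"
      using assms by (simp add: a_def s_def field_simps)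
    moreover have "0 \<le> real j * s" "real j * s \<le> real n * s"
      using \<open>j \<le> n\<close> \<open>s > 0\<close> by (auto intro: mult_right_mono)
    ultimately show "\<bar>poly p (a + real j * s) - v\<bar> \<le> \<delta>"
      using close[of "l * n + j"] p(2)[OF \<open>j \<le> n\<close>] y_bounds ns by auto
  qed
  then show ?thesis
    using \<open>v \<ge> 0\<close> by (auto simp: spline_val_def p_def l_def max_def)
qed

section \<open>The softplus function\<close>

text \<open>Ensures that the error of a raw network output does not grow at the knots. For
  \<open>v \<le> u\<close> it rests on
  \<open>1 + exp u \<le> exp (u - v) * (1 + exp v)\<close>.\<close>

lemma softplus_lipschitz: "\<bar>softplus u - softplus v\<bar> \<le> \<bar>u - v\<bar>"
proof -
  have *: "softplus u - softplus v \<le> u - v" "softplus v \<le> softplus u" if "v \<le> u" for u v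
  proof -
    show "softplus v \<le> softplus u"
      using that by (simp add: softplus_def add_pos_pos)
    have "1 + exp u \<le> exp (u - v) * (1 + exp v)"
      using that by (simp add: distrib_left flip: exp_add)
    then have "ln (1 + exp u) \<le> ln (exp (u - v) * (1 + exp v))"
      by (subst ln_le_cancel_iff) (auto simp: add_pos_pos)
    also have "\<dots> = u - v + ln (1 + exp v)"
      by (subst ln_mult) (auto simp: add_pos_pos add_pos_pos[THEN less_imp_neq, symmetric])
    finally show "softplus u - softplus v \<le> u - v"
      by (simp add: softplus_def)
  qed
  show ?thesis
    using *[of u v] *[of v u] by linarith
qed

lemma softplus_ln_exp: "z > 0 \<Longrightarrow> softplus (ln (exp z - 1)) = z"
  by (simp add: softplus_def)

lemma compact_unit_cube: "compact (unit_cube :: (real^'n::finite) set)"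
proof -
  have "unit_cube = cbox (0 :: real^'n) (\<chi> i. 1)"
    by (auto simp: unit_cube_def mem_box_cart)
  then show ?thesis
    by (metis compact_cbox)
qed

section \<open>Assembly of the SPICE model\<close>

theorem theorem1:
  fixes \<sigma> :: "real \<Rightarrow> real" and f :: "real^'n \<Rightarrow> real \<Rightarrow> real"
    and n :: nat and \<epsilon> :: real
  assumes act_cont: "continuous_on UNIV \<sigma>"
    and act_nonpoly: "\<not> (\<exists>p :: real poly. \<forall>u. \<sigma> u = poly p u)"
    and deg: "n \<ge> 1"
    and f_cont: "continuous_on (unit_cube \<times> {0..1}) (\<lambda>(x, y). f x y)"
    and f_nonneg: "\<forall>x\<in>unit_cube. \<forall>y\<in>{0..1}. f x y \<ge> 0"
    and eps: "\<epsilon> > 0"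
  shows "\<exists>K m W b A c B e. K \<ge> 2 \<and>
     bdd_above ((\<lambda>(x, y). \<bar>f x y - spice_unnorm \<sigma> n K m W b A c B e x y\<bar>) ` (unit_cube \<times> {0..1})) \<and>
     (SUP (x, y)\<in>unit_cube \<times> {0..1}. \<bar>f x y - spice_unnorm \<sigma> n K m W b A c B e x y\<bar>) < \<epsilon>"
proof -
  define \<Lambda> where "\<Lambda> = real (Suc n) * real n ^ n"
  have "\<Lambda> > 0"
    using deg by (simp add: \<Lambda>_def)
  \<comment> \<open>A height deviates from \<open>f x y\<close> by at most
    \<open>3 * \<delta>\<close>: network error, lift at the knots, and variation of \<open>f\<close>
    in \<open>y\<close>. Interpolation multiplies this by \<open>\<Lambda>\<close>, giving
    \<open>\<epsilon> / 2\<close>, so the supremum stays strictly below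
    \<open>\<epsilon>\<close>.\<close>
  define \<delta> where "\<delta> = \<epsilon> / (6 * \<Lambda>)"
  have "\<delta> > 0"
    using eps \<open>\<Lambda> > 0\<close> by (simp add: \<delta>_def)
  have "uniformly_continuous_on (unit_cube \<times> {0..1}) (\<lambda>(x, y). f x y)"
    by (intro compact_uniformly_continuous f_cont compact_Times compact_unit_cube) simp
  then obtain d where d: "d > 0" "\<And>z z'. z \<in> unit_cube \<times> {0..1} \<Longrightarrow> z' \<in> unit_cube \<times> {0..1} \<Longrightarrow>
      dist z' z < d \<Longrightarrow> dist (case z' of (x, y) \<Rightarrow> f x y) (case z of (x, y) \<Rightarrow> f x y) < \<delta>"
    using \<open>\<delta> > 0\<close> unfolding uniformly_continuous_on_def by metis
  obtain M :: nat where "M \<ge> 1" and M: "1 / real M < d"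
  proof -
    obtain M :: nat where "M > 0" "inverse (real M) < d"
      using ex_inverse_of_nat_less[OF d(1)] by blast
    then show ?thesis
      using that[of M] by (simp add: inverse_eq_divide)
  qed
  have f_close: "\<bar>f x y' - f x y\<bar> \<le> \<delta>"
    if "x \<in> unit_cube" "y \<in> {0..1}" "y' \<in> {0..1}" "\<bar>y' - y\<bar> \<le> 1 / real M" for x y y'
    using d(2)[of "(x, y)" "(x, y')"] that M by (auto simp: dist_Pair_Pair dist_real_def)
  define \<theta> where "\<theta> g = real g / real (n * M)" for g
  have \<theta>: "\<theta> g \<in> {0..1}" if "g \<le> n * M" for g
    unfolding \<theta>_def using that by (cases "n * M = 0") (auto simp flip: of_nat_mult)
  \<comment> \<open>Since \<open>f\<close> may vanish, it is raised by \<open>\<delta>\<close> at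
    the knots so that the inverse of softplus is defined and continuous; the other heights aim at
    \<open>f\<close> directly.\<close>
  define r where "r g x = (if n dvd g then ln (exp (f x (\<theta> g) + \<delta>) - 1) else f x (\<theta> g))" for g x
  have "net_approximable \<sigma> unit_cube (r g)" if "g < Suc (n * M)" for g
  proof (rule net_approximable_continuous[OF compact_unit_cube act_cont act_nonpoly])
    have f_at: "continuous_on unit_cube (\<lambda>x. f x (\<theta> g))"
      by (rule continuous_on_compose2[OF f_cont, of unit_cube "\<lambda>x. (x, \<theta> g)", simplified])
        (use \<theta>[of g] that in \<open>auto intro!: continuous_intros\<close>)
    have "exp (f x (\<theta> g) + \<delta>) - 1 \<noteq> 0" if "x \<in> unit_cube" for x
      using f_nonneg that \<theta>[of g] \<open>g < Suc (n * M)\<close> \<open>\<delta> > 0\<close>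
      by (smt (verit) exp_gt_one less_Suc_eq_le)
    then show "continuous_on unit_cube (r g)"
      unfolding r_def by (cases "n dvd g") (auto intro!: continuous_intros f_at)
  qed
  from simultaneous_net_approximation[of "Suc (n * M)" \<sigma> unit_cube r, OF this \<open>\<delta> > 0\<close>]
  obtain m W b B where B: "\<And>g x. g \<le> n * M \<Longrightarrow> x \<in> unit_cube \<Longrightarrow>
      \<bar>out_layer m B (\<lambda>_. 0) (encoder \<sigma> W b x) g - r g x\<bar> < \<delta>"
    by (metis less_Suc_eq_le)
  \<comment> \<open>Zero weights and biases in the knot layer make the softmax uniform, so the knots
    are the same for every \<open>x\<close>.\<close>
  define F where "F = spice_unnorm \<sigma> n (Suc M) m W b (\<lambda>_ _. 0) (\<lambda>_. 0) B (\<lambda>_. 0)"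
  have bound: "\<bar>f x y - F x y\<bar> \<le> \<epsilon> / 2" if xy: "x \<in> unit_cube" "y \<in> {0..1}" for x y
  proof -
    define h where "h = heights n (out_layer m B (\<lambda>_. 0) (encoder \<sigma> W b x))"
    have h: "\<bar>h g - f x (\<theta> g)\<bar> \<le> 2 * \<delta>" if "g \<le> n * M" for g
    proof (cases "n dvd g")
      case True
      have "f x (\<theta> g) + \<delta> > 0"
        using f_nonneg xy(1) \<theta>[OF that] \<open>\<delta> > 0\<close> by (simp add: add_nonneg_pos)
      then have "softplus (r g x) = f x (\<theta> g) + \<delta>"
        using True by (simp add: r_def softplus_ln_exp)
      moreover have "\<bar>h g - softplus (r g x)\<bar> \<le> \<delta>"
        using True softplus_lipschitz[of _ "r g x"] B[OF that xy(1)]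
        by (smt (verit) h_def heights_def)
      ultimately show ?thesis
        by linarith
    next
      case False
      then show ?thesis
        using B[OF that xy(1)] \<open>\<delta> > 0\<close> by (simp add: h_def heights_def r_def)
    qed
    have "\<bar>h g - f x y\<bar> \<le> 3 * \<delta>"
      if "g \<le> n * M" "\<bar>real g / real (n * M) - y\<bar> \<le> 1 / real M" for g
      using h[OF that(1)] f_close[OF xy \<theta>[OF that(1)]] that(2) by (simp add: \<theta>_def)
    then have "\<bar>spline_val n (Suc M) (\<lambda>i. real i / real M) h y - f x y\<bar> \<le> \<Lambda> * (3 * \<delta>)"
      unfolding \<Lambda>_def using f_nonneg xy deg \<open>M \<ge> 1\<close> by (intro spline_val_uniform_close) auto
    also have "\<Lambda> * (3 * \<delta>) = \<epsilon> / 2"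
      using \<open>\<Lambda> > 0\<close> by (simp add: \<delta>_def)
    also have "spline_val n (Suc M) (\<lambda>i. real i / real M) h y = F x y"
    proof -
      have "out_layer m (\<lambda>_ _. 0) (\<lambda>_. 0) (encoder \<sigma> W b x) = (\<lambda>_. 0)"
        by (simp add: fun_eq_iff out_layer_def)
      moreover have "knots (Suc M) (\<lambda>_. 0) = (\<lambda>i. real i / real M)"
        by (simp add: fun_eq_iff knots_zero)
      ultimately show ?thesis
        by (simp add: F_def spice_unnorm_def h_def Let_def)
    qed
    finally show ?thesis
      by (simp add: abs_minus_commute)
  qed
  \<comment> \<open>\<open>cSUP_least\<close> requires a nonempty index set.\<close>
  have "(0 :: real^'n, 0 :: real) \<in> unit_cube \<times> {0..1}"
    by (simp add: unit_cube_def)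
  then have "(SUP (x, y)\<in>unit_cube \<times> {0..1}. \<bar>f x y - F x y\<bar>) \<le> \<epsilon> / 2"
    by (intro cSUP_least) (use bound in auto)
  moreover have "bdd_above ((\<lambda>(x, y). \<bar>f x y - F x y\<bar>) ` (unit_cube \<times> {0..1}))"
    using bound by (auto intro!: bdd_aboveI[of _ "\<epsilon> / 2"])
  moreover have "Suc M \<ge> 2"
    using \<open>M \<ge> 1\<close> by simp
  ultimately show ?thesis
    using eps unfolding F_def
    by (intro exI[of _ "Suc M"] exI[of _ m] exI[of _ W] exI[of _ b] exI[of _ "\<lambda>_ _. 0"]
        exI[of _ "\<lambda>_. 0"] exI[of _ B] exI[of _ "\<lambda>_. 0"] conjI) auto
qed

end
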